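(* Let $M$ be a Puiseux monoid. Then the following statements are equivalent. (1) $\mathrm{gp}(M)$ is dense in $\mathbb{R}$. (2) $\widetilde{M}$ is dense in $\mathbb{R}_{\ge 0}$. (3) $M$ is not finitely generated.
   Context: A Puiseux monoid is an additive submonoid of $(\mathbb{Q}_{\ge 0},+)$; it is finitely generated if there is a finite subset $S\subseteq M$ such that no proper submonoid of $M$ contains $S$. The difference group of a Puiseux monoid $M$ is the subgroup $\mathrm{gp}(M)=\{x-y\mid x,y\in M\}$ of $(\mathbb{Q},+)$. The root closure of $M$ is $\widetilde{M}=\{x\in\mathrm{gp}(M)\mid nx\in M\text{ for some }n\in\mathbb{N}\}$, where $\mathbb{N}$ is the set of positive integers. Density is with respect to the Euclidean topology. *)

theory Defs
  imports "HOL-Analysis.Analysis"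
begin

definition add_submonoid :: "'a::comm_monoid_add set \<Rightarrow> bool" where
  "add_submonoid M \<longleftrightarrow> 0 \<in> M \<and> (\<forall>x\<in>M. \<forall>y\<in>M. x + y \<in> M)"

definition puiseux_monoid :: "rat set \<Rightarrow> bool" where
  "puiseux_monoid M \<longleftrightarrow> add_submonoid M \<and> M \<subseteq> {0..}"

definition fin_generated :: "'a::comm_monoid_add set \<Rightarrow> bool" where
  "fin_generated M \<longleftrightarrow>
     (\<exists>S. finite S \<and> S \<subseteq> M \<and> \<not> (\<exists>N. add_submonoid N \<and> N \<subset> M \<and> S \<subseteq> N))"

definition gp :: "'a::ab_group_add set \<Rightarrow> 'a set" where
  "gp M = {x - y | x y. x \<in> M \<and> y \<in> M}"

definition root_closure :: "rat set \<Rightarrow> rat set" where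
  "root_closure M = {x \<in> gp M. \<exists>n::nat. n > 0 \<and> of_nat n * x \<in> M}"

(* Sets of rationals are viewed inside the real line, and density in Y refers to the
   subspace topology on Y. The inclusion conjunct is needed because closure_of
   silently intersects its argument with the carrier of the topology. *)
definition dense_in_reals :: "rat set \<Rightarrow> real set \<Rightarrow> bool" where
  "dense_in_reals X Y \<longleftrightarrow>
     real_of_rat ` X \<subseteq> Y \<and> top_of_set Y closure_of (real_of_rat ` X) = Y"

end

theory Submission
  imports Defs
begin

text \<open>
  All three conditions are compared with the condition that \<open>gp M\<close> has arbitrarily small positive
  elements. For the two density statements, the integer multiples of a small positive element of
  \<open>gp M\<close> approximate every real number, and the root closure is just the nonnegative part of
  \<open>gp M\<close>. If \<open>M\<close> is finitely generated, a common denominator of the generators bounds the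
  positive elements of \<open>gp M\<close> from below. Conversely, suppose that the positive elements of
  \<open>gp M\<close> are bounded away from \<open>0\<close>, and let \<open>d\<close> be a positive element of \<open>M\<close>. Then \<open>gp M\<close> has
  only finitely many elements in \<open>[0, d)\<close>, so the Apery set \<open>{m \<in> M. m - d \<notin> M}\<close>, whose elements
  are pairwise incongruent modulo \<open>d\<close>, is finite; together with \<open>d\<close> it generates \<open>M\<close>.
\<close>

section \<open>Multiples in submonoids and difference groups\<close>

lemma add_submonoid_zero: "add_submonoid M \<Longrightarrow> 0 \<in> M"
  by (simp add: add_submonoid_def)

lemma add_submonoid_add: "add_submonoid M \<Longrightarrow> x \<in> M \<Longrightarrow> y \<in> M \<Longrightarrow> x + y \<in> M"
  by (simp add: add_submonoid_def)

lemma add_submonoid_of_nat_mult: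
  fixes M :: "'a::comm_semiring_1 set"
  assumes "add_submonoid M" "x \<in> M"
  shows "of_nat k * x \<in> M"
  by (induction k) (use assms in \<open>auto simp: add_submonoid_def algebra_simps\<close>)

lemma gp_of_int_mult:
  fixes M :: "'a::comm_ring_1 set"
  assumes "add_submonoid M" "x \<in> gp M"
  shows "of_int k * x \<in> gp M"
proof -
  obtain a b where ab: "a \<in> M" "b \<in> M" "x = a - b"
    using assms(2) unfolding gp_def by blast
  note mult = add_submonoid_of_nat_mult[OF assms(1)]
  show ?thesis
  proof (cases k rule: int_cases2)
    case (nonneg n)
    then have "of_int k * x = of_nat n * a - of_nat n * b"
      by (simp add: ab algebra_simps)
    then show ?thesis
      using mult[OF ab(1), of n] mult[OF ab(2), of n] unfolding gp_def by blast
  next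
    case (nonpos n)
    then have "of_int k * x = of_nat n * b - of_nat n * a"
      by (simp add: ab algebra_simps)
    then show ?thesis
      using mult[OF ab(1), of n] mult[OF ab(2), of n] unfolding gp_def by blast
  qed
qed

section \<open>Density in terms of small positive elements\<close>

lemma dense_in_reals_iff_approachable:
  "dense_in_reals X Y \<longleftrightarrow>
     real_of_rat ` X \<subseteq> Y \<and> (\<forall>y\<in>Y. \<forall>e>0. \<exists>x\<in>X. \<bar>real_of_rat x - y\<bar> < e)"
proof -
  have "top_of_set Y closure_of (real_of_rat ` X) = Y \<inter> closure (real_of_rat ` X)"
    if "real_of_rat ` X \<subseteq> Y"
    using that by (simp add: closure_of_subtopology Int_absorb1)
  then have "dense_in_reals X Y \<longleftrightarrow>
      real_of_rat ` X \<subseteq> Y \<and> (\<forall>y\<in>Y. y \<in> closure (real_of_rat ` X))"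
    unfolding dense_in_reals_def by blast
  then show ?thesis
    by (simp add: closure_approachable dist_real_def)
qed

definition has_small_positives :: "rat set \<Rightarrow> bool" where
  "has_small_positives G \<longleftrightarrow> (\<forall>e>0. \<exists>x\<in>G. 0 < x \<and> x < e)"

text \<open>Approximating \<open>e / 2\<close> with error below \<open>e / 2\<close> lands strictly
  between 0 and \<open>e\<close>.\<close>

lemma has_small_positives_if_dense:
  assumes "dense_in_reals X Y" "{0<..} \<subseteq> Y"
  shows "has_small_positives X"
  unfolding has_small_positives_def
proof (intro allI impI)
  fix e :: rat
  assume "0 < e"
  then have "real_of_rat e / 2 > 0"
    by simp
  moreover from this have "real_of_rat e / 2 \<in> Y"
    using assms(2) by auto
  ultimately obtain x
    where x: "x \<in> X" "\<bar>real_of_rat x - real_of_rat e / 2\<bar> < real_of_rat e / 2"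
    using assms(1) unfolding dense_in_reals_iff_approachable by blast
  then have "0 < real_of_rat x" "real_of_rat x < real_of_rat e"
    by linarith+
  then show "\<exists>x\<in>X. 0 < x \<and> x < e"
    using x(1) by (auto simp: of_rat_less)
qed

text \<open>Rounding \<open>y\<close> down to a multiple of \<open>x\<close> costs less than
  \<open>x\<close>. The sign of \<open>k\<close> is recorded so that for \<open>y \<ge> 0\<close>
  the approximant stays nonnegative, as density in the half-line requires.\<close>

lemma has_small_positives_approx:
  assumes "has_small_positives G" "e > 0"
  obtains x k where "x \<in> G" "0 < x" "\<bar>real_of_rat (of_int k * x) - y\<bar> < e" "y \<ge> 0 \<Longrightarrow> k \<ge> 0"
proof -
  \<comment> \<open>\<open>has_small_positives\<close> accepts only rational bounds, whereas
    \<open>e\<close> is real, so a rational is inserted below \<open>e\<close>.\<close>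
  obtain q where q: "0 < real_of_rat q" "real_of_rat q < e"
    using of_rat_dense[OF assms(2)] by blast
  then obtain x where x: "x \<in> G" "0 < x" "x < q"
    using assms(1) unfolding has_small_positives_def by auto
  define r where "r = real_of_rat x"
  have r: "0 < r" "r < e"
    using x q unfolding r_def by (simp_all, meson less_trans of_rat_less)
  have "of_int \<lfloor>y / r\<rfloor> * r \<le> y" "y < (of_int \<lfloor>y / r\<rfloor> + 1) * r"
    using r(1) by (simp_all add: floor_divide_lower floor_divide_upper)
  then have "\<bar>real_of_rat (of_int \<lfloor>y / r\<rfloor> * x) - y\<bar> < e"
    using r by (simp add: of_rat_mult r_def[symmetric] algebra_simps)
  moreover have "\<lfloor>y / r\<rfloor> \<ge> 0" if "y \<ge> 0"
    using that r(1) by simp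
  ultimately show thesis
    using that x by blast
qed

lemma dense_gp_iff:
  assumes "add_submonoid M"
  shows "dense_in_reals (gp M) UNIV \<longleftrightarrow> has_small_positives (gp M)"
proof
  assume small: "has_small_positives (gp M)"
  have "\<exists>x\<in>gp M. \<bar>real_of_rat x - y\<bar> < e" if "e > 0" for y e
    using has_small_positives_approx[OF small that] gp_of_int_mult[OF assms] by metis
  then show "dense_in_reals (gp M) UNIV"
    unfolding dense_in_reals_iff_approachable by blast
qed (simp add: has_small_positives_if_dense)

lemma dense_nonneg_gp_iff:
  assumes "add_submonoid M"
  shows "dense_in_reals (gp M \<inter> {0..}) {0..} \<longleftrightarrow> has_small_positives (gp M)"
proof
  assume small: "has_small_positives (gp M)"
  have "\<exists>x\<in>gp M \<inter> {0..}. \<bar>real_of_rat x - y\<bar> < e" if e: "e > 0" and y: "y \<ge> 0" for y e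
  proof -
    obtain x k where xk: "x \<in> gp M" "0 < x" "\<bar>real_of_rat (of_int k * x) - y\<bar> < e" "k \<ge> 0"
      using has_small_positives_approx[OF small e] y by metis
    then have "of_int k * x \<in> gp M \<inter> {0..}"
      using gp_of_int_mult[OF assms] by simp
    then show ?thesis
      using xk(3) by blast
  qed
  then show "dense_in_reals (gp M \<inter> {0..}) {0..}"
    unfolding dense_in_reals_iff_approachable by auto
next
  assume "dense_in_reals (gp M \<inter> {0..}) {0..}"
  then have "has_small_positives (gp M \<inter> {0..})"
    by (rule has_small_positives_if_dense) auto
  then show "has_small_positives (gp M)"
    unfolding has_small_positives_def by blast
qed

section \<open>The root closure\<close>

lemma rat_common_multiple:
  fixes a x :: rat
  assumes "0 < a" "0 < x"
  obtains m n :: nat where "0 < n" "of_nat n * x = of_nat m * a"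
proof -
  obtain p q :: int where pq: "x / a = of_int p / of_int q" "q > 0"
    by (metis quotient_of_denom_pos quotient_of_div surj_pair)
  have "0 < x / a"
    using assms by simp
  with pq have "p > 0"
    by (simp add: zero_less_divide_iff)
  have "of_int q * x = of_int p * a"
    using pq assms by (simp add: field_simps)
  then have "of_nat (nat q) * x = of_nat (nat p) * a"
    using \<open>p > 0\<close> \<open>q > 0\<close> by simp
  then show thesis
    using that \<open>q > 0\<close> by (metis zero_less_nat_eq)
qed

text \<open>If \<open>x = a - b\<close> is positive with \<open>a\<close>, \<open>b\<close> in
  \<open>M\<close>, then \<open>a = x + b\<close> is positive too, and two positive rationals have a
  common multiple \<open>n x = m a\<close>, which lies in \<open>M\<close>. In the other direction,
  a negative \<open>x\<close> would have only negative positive-integer multiples, and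
  \<open>M\<close> contains none.\<close>

lemma root_closure_eq_nonneg_gp:
  assumes "puiseux_monoid M"
  shows "root_closure M = gp M \<inter> {0..}"
proof -
  have M: "add_submonoid M" "M \<subseteq> {0..}"
    using assms unfolding puiseux_monoid_def by auto
  have "0 \<le> x" if "n > 0" "of_nat n * x \<in> M" for x and n :: nat
    using that M(2) by (auto simp: zero_le_mult_iff)
  moreover have "\<exists>n::nat. n > 0 \<and> of_nat n * x \<in> M" if x: "x \<in> gp M" "0 \<le> x" for x
  proof (cases "x = 0")
    case True
    then show ?thesis
      using add_submonoid_zero[OF M(1)] by (auto intro: exI[of _ 1])
  next
    case False
    obtain a b where ab: "a \<in> M" "b \<in> M" "x = a - b"
      using x(1) unfolding gp_def by blast
    then have "0 < a" "0 < x"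
      using x(2) False M(2) by force+
    then obtain m n :: nat where "0 < n" "of_nat n * x = of_nat m * a"
      by (rule rat_common_multiple)
    then show ?thesis
      using add_submonoid_of_nat_mult[OF M(1) ab(1), of m] by auto
  qed
  ultimately show ?thesis
    unfolding root_closure_def by auto
qed

section \<open>Finite generation gives a gap above 0\<close>

lemma finite_rat_common_denominator:
  fixes S :: "rat set"
  assumes "finite S"
  obtains d :: int where "d > 0" "\<And>x. x \<in> S \<Longrightarrow> of_int d * x \<in> \<int>"
proof -
  have "\<exists>d::int. d > 0 \<and> (\<forall>x\<in>S. of_int d * x \<in> \<int>)"
    using assms
  proof (induction S)
    case (insert x S)
    then obtain d :: int where d: "d > 0" "\<forall>x\<in>S. of_int d * x \<in> \<int>"
      by blast
    obtain p q :: int where pq: "x = of_int p / of_int q" "q > 0"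
      by (metis quotient_of_denom_pos quotient_of_div surj_pair)
    have "of_int (d * q) * x = of_int (d * p)"
      using pq by simp
    moreover have "of_int (d * q) * y \<in> \<int>" if "y \<in> S" for y
    proof -
      have "of_int (d * q) * y = of_int q * (of_int d * y)"
        by simp
      then show ?thesis
        using d(2) that by (metis Ints_mult Ints_of_int)
    qed
    ultimately have "\<forall>y\<in>insert x S. of_int (d * q) * y \<in> \<int>"
      by (metis Ints_of_int insert_iff)
    then show ?case
      using d(1) pq(2) by (meson mult_pos_pos)
  qed (auto intro: exI[of _ 1])
  then show thesis
    using that by blast
qed

lemma fin_generated_imp_gap:
  assumes "add_submonoid M" "fin_generated M"
  shows "\<not> has_small_positives (gp M)"
proof -
  obtain S where S: "finite S" "S \<subseteq> M" and min: "\<And>N. add_submonoid N \<Longrightarrow> S \<subseteq> N \<Longrightarrow> \<not> N \<subset> M"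
    using assms(2) unfolding fin_generated_def by blast
  obtain d :: int where d: "d > 0" "\<And>x. x \<in> S \<Longrightarrow> of_int d * x \<in> \<int>"
    using finite_rat_common_denominator[OF S(1)] by blast
  \<comment> \<open>This submonoid contains the generators, so minimality forces it to be all of
    \<open>M\<close>. Hence \<open>gp M\<close> consists of multiples of
    \<open>1 / d\<close>.\<close>
  let ?N = "{x \<in> M. of_int d * x \<in> \<int>}"
  have "add_submonoid ?N"
    using assms(1) by (auto simp: add_submonoid_def distrib_left)
  then have "\<not> ?N \<subset> M"
    using S(2) d(2) by (intro min) auto
  then have int: "of_int d * x \<in> \<int>" if "x \<in> M" for x
    using that by blast
  have "1 / of_int d \<le> x" if "x \<in> gp M" "0 < x" for x
  proof -
    have "of_int d * x \<in> \<int>"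
      using that(1) int by (auto simp: gp_def right_diff_distrib)
    then obtain k where k: "of_int d * x = of_int k"
      by (auto elim: Ints_cases)
    have "0 < of_int d * x"
      using d(1) that(2) by simp
    then have "k \<ge> 1"
      unfolding k by simp
    then have "1 \<le> of_int d * x"
      unfolding k by simp
    then show ?thesis
      using d(1) by (simp add: field_simps)
  qed
  moreover have "(0::rat) < 1 / of_int d"
    using d(1) by simp
  ultimately show ?thesis
    unfolding has_small_positives_def by (meson not_le)
qed

section \<open>A gap above 0 gives finite generation\<close>

lemma finite_bounded_if_separated:
  fixes A :: "rat set"
  assumes e: "e > 0" and sep: "\<And>x y. x \<in> A \<Longrightarrow> y \<in> A \<Longrightarrow> x < y \<Longrightarrow> e \<le> y - x"
    and bd: "A \<subseteq> {a..b}"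
  shows "finite A"
proof -
  \<comment> \<open>Points at distance at least \<open>e\<close> lie in different cells
    \<open>[k e, (k + 1) e)\<close>, and a bounded interval meets only finitely many cells.\<close>
  have less: "\<lfloor>x / e\<rfloor> < \<lfloor>y / e\<rfloor>" if "x \<in> A" "y \<in> A" "x < y" for x y
  proof -
    have "x / e + 1 \<le> y / e"
      using divide_right_mono[OF sep[OF that], of e] e by (simp add: diff_divide_distrib)
    then show ?thesis
      by linarith
  qed
  have "inj_on (\<lambda>x. \<lfloor>x / e\<rfloor>) A"
    by (rule linorder_inj_onI') (use less in force)
  moreover have "(\<lambda>x. \<lfloor>x / e\<rfloor>) ` A \<subseteq> {\<lfloor>a / e\<rfloor>..\<lfloor>b / e\<rfloor>}"
    using subsetD[OF bd] e by (auto intro!: floor_mono divide_right_mono)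
  ultimately show ?thesis
    by (meson finite_atLeastAtMost_int inj_on_finite)
qed

lemma gap_imp_fin_generated:
  assumes M: "puiseux_monoid M" and gap: "\<not> has_small_positives (gp M)"
  shows "fin_generated M"
proof -
  have sub: "add_submonoid M" and nonneg: "\<And>x. x \<in> M \<Longrightarrow> 0 \<le> x"
    using M unfolding puiseux_monoid_def by auto
  show ?thesis
  proof (cases "M = {0}")
    case True
    then show ?thesis
      \<comment> \<open>Every submonoid contains 0, so the empty set generates the trivial
        monoid.\<close>
      unfolding fin_generated_def by (intro exI[of _ "{}"]) (auto simp: add_submonoid_def)
  next
    case False
    then obtain d where "d \<in> M" "d \<noteq> 0"
      using add_submonoid_zero[OF sub] by blast
    then have d: "d \<in> M" "d > 0"
      using nonneg by (auto simp: less_le)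
    obtain e where e: "e > 0" "\<And>x. x \<in> gp M \<Longrightarrow> 0 < x \<Longrightarrow> e \<le> x"
      using gap unfolding has_small_positives_def by (metis not_less)
    define A where "A = {m \<in> M. m - d \<notin> M}"
    define res where "res m = m - of_int \<lfloor>m / d\<rfloor> * d" for m
    have res_bd: "0 \<le> res m" "res m < d" for m
      using floor_divide_lower[OF d(2), of m] floor_divide_upper[OF d(2), of m]
      unfolding res_def by (simp_all add: algebra_simps)
    have "inj_on res A"
    proof (rule linorder_inj_onI')
      fix x y
      assume xy: "x \<in> A" "y \<in> A" "x < y"
      show "res x \<noteq> res y"
      proof
        define k where "k = \<lfloor>y / d\<rfloor> - \<lfloor>x / d\<rfloor>"
        assume "res x = res y"
        then have eq: "y = x + of_int k * d"
          unfolding res_def k_def by (simp add: algebra_simps)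
        then have "of_int k * d > 0"
          using xy(3) by simp
        then have "k > 0"
          using d(2) by (simp add: zero_less_mult_iff)
        \<comment> \<open>Since \<open>k \<ge> 1\<close>, removing one copy of \<open>d\<close>
          leaves a natural multiple of \<open>d\<close>, so \<open>y - d\<close> stays in
          \<open>M\<close>, against \<open>y \<in> A\<close>.\<close>
        then have "y - d = x + of_nat (nat (k - 1)) * d"
          using eq by (simp add: algebra_simps)
        then have "y - d \<in> M"
          using xy(1) add_submonoid_add[OF sub] add_submonoid_of_nat_mult[OF sub d(1)]
          unfolding A_def by auto
        then show False
          using xy(2) unfolding A_def by blast
      qed
    qed
    moreover have "finite (res ` A)"
    proof (rule finite_bounded_if_separated[OF e(1)])
      show "res ` A \<subseteq> {0..d}"
        using res_bd by (force intro: less_imp_le)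
    next
      fix x y
      assume "x \<in> res ` A" "y \<in> res ` A" "x < y"
      then obtain a b where ab: "a \<in> M" "b \<in> M" "x = res a" "y = res b"
        unfolding A_def by blast
      define i j where "i = nat \<lfloor>a / d\<rfloor>" and "j = nat \<lfloor>b / d\<rfloor>"
      \<comment> \<open>Moving each subtracted multiple of \<open>d\<close> to the other side
        exhibits \<open>y - x\<close> as a difference of two elements of \<open>M\<close>. The
        floors are nonnegative because \<open>M\<close> is, so \<open>nat\<close> loses
        nothing.\<close>
      have "y - x = (b + of_nat i * d) - (a + of_nat j * d)"
        using ab nonneg d(2) by (simp add: res_def i_def j_def)
      moreover have "b + of_nat i * d \<in> M" "a + of_nat j * d \<in> M"
        using ab add_submonoid_add[OF sub] add_submonoid_of_nat_mult[OF sub d(1)] by auto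
      ultimately have "y - x \<in> gp M"
        unfolding gp_def by blast
      then show "e \<le> y - x"
        using e(2) \<open>x < y\<close> by simp
    qed
    ultimately have fin: "finite A"
      using finite_imageD by blast
    have gen: "m \<in> N" if N: "add_submonoid N" "insert d A \<subseteq> N" and m: "m \<in> M" for m N
      using m
    \<comment> \<open>Subtract \<open>d\<close> as long as the result stays in \<open>M\<close>; the
      element at which this stops lies in \<open>A\<close>.\<close>
    proof (induction "nat \<lfloor>m / d\<rfloor>" arbitrary: m rule: less_induct)
      case less
      show ?case
      proof (cases "m - d \<in> M")
        case True
        \<comment> \<open>Without this bound, \<open>nat\<close> could truncate both floors to 0 and
          the measure would not drop.\<close>
        then have "\<lfloor>(m - d) / d\<rfloor> \<ge> 0"
          using nonneg[OF True] d(2) by simp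
        moreover have "\<lfloor>(m - d) / d\<rfloor> = \<lfloor>m / d\<rfloor> - 1"
          using d(2) by (simp add: diff_divide_distrib)
        ultimately have "m - d \<in> N"
          using less.hyps True by simp
        then show ?thesis
          using add_submonoid_add[OF N(1), of "m - d" d] N(2) by simp
      next
        case False
        then show ?thesis
          using less.prems N(2) unfolding A_def by blast
      qed
    qed
    show ?thesis
      unfolding fin_generated_def
    proof (intro exI[of _ "insert d A"] conjI)
      show "finite (insert d A)"
        using fin by simp
      show "insert d A \<subseteq> M"
        using d(1) unfolding A_def by blast
      show "\<not> (\<exists>N. add_submonoid N \<and> N \<subset> M \<and> insert d A \<subseteq> N)"
        using gen by blast
    qed
  qed
qed

theorem proposition4p3:
  fixes M :: "rat set"
  assumes "puiseux_monoid M"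
  shows "(dense_in_reals (gp M) UNIV \<longleftrightarrow> dense_in_reals (root_closure M) {0..}) \<and>
         (dense_in_reals (root_closure M) {0..} \<longleftrightarrow> \<not> fin_generated M)"
proof -
  have M: "add_submonoid M"
    using assms unfolding puiseux_monoid_def by blast
  have "has_small_positives (gp M) \<longleftrightarrow> \<not> fin_generated M"
    using fin_generated_imp_gap[OF M] gap_imp_fin_generated[OF assms] by blast
  then show ?thesis
    unfolding root_closure_eq_nonneg_gp[OF assms] dense_gp_iff[OF M] dense_nonneg_gp_iff[OF M]
    by blast
qed

end
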